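(* Let $(M,\mathscr F,\sigma)$ be a sigma-finite measure space, let $(W_A^{(\sigma)})$ be a Gaussian process associated with it, realized on a probability space $(\Omega,\mathscr B,P)$, and let $\mathbb E$ denote expectation with respect to $P$. Then for any $A\in\mathscr F$ with $\sigma(A)<\infty$ and every partition $(A_k)_{k\in\mathbb N}$ of $A$, $$\mathbb E\left[\Big|\sigma(A)-\sum_k\left(W_{A_k}^{(\sigma)}\right)^2\Big|^2\right]=2\sum_k(\sigma(A_k))^2=2\sum_k\left(\mathbb E\left[(W_{A_k}^{(\sigma)})^2\right]\right)^2.$$
   Context: A Gaussian process associated with the sigma-finite measure space $(M,\mathscr F,\sigma)$ is a family $(W_A^{(\sigma)})$ of real random variables on a probability space, indexed by the sets $A\in\mathscr F$ with $\sigma(A)<\infty$, such that every finite subfamily is jointly Gaussian, $\mathbb E[W_A^{(\sigma)}]=0$, and $\mathbb E[W_A^{(\sigma)}W_B^{(\sigma)}]=\sigma(A\cap B)$. A partition of $A$ is a finite or countable family of pairwise disjoint sets $A_1,A_2,\ldots\in\mathscr F$ with $A=\bigcup_kA_k$. *)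

theory Defs
  imports "HOL-Probability.Probability"
begin

text \<open>
  Point masses count as Gaussian (variance zero). This is forced by the covariance
  condition: a set of measure zero has a variable with variance zero. The library's
  \<^const>\<open>normal_density\<close> is a probability density for positive standard deviation only.
\<close>
definition gaussian_rv :: "'w measure \<Rightarrow> ('w \<Rightarrow> real) \<Rightarrow> bool" where
  "gaussian_rv P X \<longleftrightarrow> X \<in> borel_measurable P \<and>
     ((\<exists>m. distr P borel X = return borel m) \<or>
      (\<exists>m s. 0 < s \<and> distributed P lborel X (\<lambda>x. ennreal (normal_density m s x))))"

text \<open>
  Joint Gaussianity of a finite family, by linear combinations. The covariance matrix may
  be singular, so a definition through a joint density would be too narrow.
\<close>
definition jointly_gaussian :: "'w measure \<Rightarrow> 'i set \<Rightarrow> ('i \<Rightarrow> 'w \<Rightarrow> real) \<Rightarrow> bool" where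
  "jointly_gaussian P J X \<longleftrightarrow>
     (\<forall>c :: 'i \<Rightarrow> real. gaussian_rv P (\<lambda>\<omega>. \<Sum>j\<in>J. c j * X j \<omega>))"

definition finite_measure_sets :: "'a measure \<Rightarrow> 'a set set" where
  "finite_measure_sets M = {A \<in> sets M. emeasure M A < \<infinity>}"

text \<open>The values of \<open>W\<close> outside \<^term>\<open>finite_measure_sets M\<close> are irrelevant.\<close>
definition gaussian_process :: "'a measure \<Rightarrow> 'w measure \<Rightarrow> ('a set \<Rightarrow> 'w \<Rightarrow> real) \<Rightarrow> bool" where
  "gaussian_process M P W \<longleftrightarrow>
     (\<forall>A \<in> finite_measure_sets M. W A \<in> borel_measurable P) \<and>
     (\<forall>J. finite J \<and> J \<subseteq> finite_measure_sets M \<longrightarrow> jointly_gaussian P J W) \<and>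
     (\<forall>A \<in> finite_measure_sets M. (\<integral>\<omega>. W A \<omega> \<partial>P) = 0) \<and>
     (\<forall>A \<in> finite_measure_sets M. \<forall>B \<in> finite_measure_sets M.
        (\<integral>\<omega>. W A \<omega> * W B \<omega> \<partial>P) = measure M (A \<inter> B))"

text \<open>The index set \<open>I\<close> is finite for finite partitions and infinite for countable ones.\<close>
definition is_partition :: "'a measure \<Rightarrow> 'a set \<Rightarrow> nat set \<Rightarrow> (nat \<Rightarrow> 'a set) \<Rightarrow> bool" where
  "is_partition M A I Q \<longleftrightarrow>
     (\<forall>k\<in>I. Q k \<in> sets M) \<and> disjoint_family_on Q I \<and> A = (\<Union>k\<in>I. Q k)"

end

theory Submission
  imports Defs
begin

text \<open>
  For disjoint \<open>A\<close>, \<open>B\<close> and \<open>X = W(A)\<close>, \<open>Y = W(B)\<close>, the polarisation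
  \<open>(X + Y)\<^sup>4 + (X - Y)\<^sup>4 = 2 X\<^sup>4 + 12 X\<^sup>2 Y\<^sup>2 + 2 Y\<^sup>4\<close> reduces the mixed moment
  \<open>E [X\<^sup>2 Y\<^sup>2] = \<sigma>(A) \<sigma>(B)\<close> to the fourth moments \<open>3 v\<^sup>2\<close> of one-dimensional centred Gaussians, so
  independence is never needed. The partial sums of \<open>W(A\<^sub>k)\<^sup>2\<close> and their squares then increase to
  limits whose expectations \<open>\<sigma>(A)\<close> and \<open>\<sigma>(A)\<^sup>2 + 2 \<Sum> \<sigma>(A\<^sub>k)\<^sup>2\<close> follow by monotone convergence.
\<close>

section \<open>Unordered sums of nonnegative reals\<close>

text \<open>This makes an unordered sum of functions measurable, through countable sums in
  \<open>ennreal\<close>. The equation survives divergence because the defaults agree: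
  \<open>infsum\<close> is then 0, and so is \<open>enn2real top\<close>.\<close>

lemma infsum_nonneg_conv_enn2real:
  fixes f :: "nat \<Rightarrow> real"
  assumes "\<And>k. 0 \<le> f k"
  shows "infsum f I = enn2real (\<Sum>k. ennreal (if k \<in> I then f k else 0))"
proof -
  let ?g = "\<lambda>k. if k \<in> I then f k else 0"
  have nonneg: "0 \<le> ?g k" for k
    using assms by simp
  have "infsum f I = infsum ?g UNIV"
    by (rule infsum_cong_neutral) auto
  also have "\<dots> = enn2real (\<Sum>k. ennreal (?g k))"
  proof (cases "summable ?g")
    case True
    then have "infsum ?g UNIV = suminf ?g"
      by (intro infsumI sums_nonneg_imp_has_sum summable_sums nonneg)
    then show ?thesis
      using True by (simp add: suminf_ennreal2[OF nonneg True] suminf_nonneg[OF True nonneg])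
  next
    case False
    then have "(\<Sum>k. ennreal (?g k)) = top"
      using summable_suminf_not_top[of ?g] nonneg by blast
    moreover have "infsum ?g UNIV = 0"
      using False summable_on_UNIV_nonneg_real_iff[of ?g] nonneg
      by (intro infsum_not_exists) blast
    ultimately show ?thesis by simp
  qed
  finally show ?thesis .
qed

section \<open>Moments of centred Gaussian variables\<close>

text \<open>A centred point mass sits at 0, so both sides vanish; otherwise the moments of the
  normal density apply.\<close>

lemma (in prob_space) gaussian_rv_fourth_moment:
  assumes "gaussian_rv M X" and mean: "expectation X = 0"
  shows "integrable M (\<lambda>x. X x ^ 4)"
    and "expectation (\<lambda>x. X x ^ 4) = 3 * (expectation (\<lambda>x. (X x)\<^sup>2))\<^sup>2"
proof -
  have [measurable]: "X \<in> borel_measurable M"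
    using assms by (simp add: gaussian_rv_def)
  consider (point) m where "distr M borel X = return borel m"
    | (normal) m s where "0 < s" "distributed M lborel X (\<lambda>x. ennreal (normal_density m s x))"
    using assms unfolding gaussian_rv_def by blast
  then have "integrable M (\<lambda>x. X x ^ 4) \<and>
    expectation (\<lambda>x. X x ^ 4) = 3 * (expectation (\<lambda>x. (X x)\<^sup>2))\<^sup>2"
  proof cases
    case point
    have int: "integrable M (\<lambda>x. g (X x))" and lint: "expectation (\<lambda>x. g (X x)) = g m"
      if [measurable]: "g \<in> borel_measurable borel" for g :: "real \<Rightarrow> real"
    proof -
      have "AE y in distr M borel X. y = m"
        unfolding point by (subst AE_return) auto
      then have ae: "AE x in M. g (X x) = g m"
        by (subst (asm) AE_distr_iff) auto
      show "expectation (\<lambda>x. g (X x)) = g m"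
        using integral_cong_AE[OF _ _ ae] by (simp add: prob_space)
      have "integrable M (\<lambda>x. g (X x)) \<longleftrightarrow> integrable M (\<lambda>x. g m)"
        by (rule integrable_cong_AE[OF _ _ ae]) auto
      then show "integrable M (\<lambda>x. g (X x))" by simp
    qed
    have "m = 0"
      using mean lint[of "\<lambda>x. x"] by simp
    then show ?thesis
      using int[of "\<lambda>x. x ^ 4"] lint[of "\<lambda>x. x ^ 4"] lint[of "\<lambda>x. x\<^sup>2"] by simp
  next
    case normal
    have m: "m = 0"
      using normal_distributed_expectation[OF normal] mean by simp
    \<comment> \<open>The even moment of order 2k with k = 2 is 4! / ((2/s^2)^2 * 2!) = 3
      s^4.\<close>
    have moment: "has_bochner_integral lborel (\<lambda>x. normal_density 0 s x * x ^ 4) (3 * s ^ 4)"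
      using normal_moment_even[OF normal(1), of 0 2] normal(1)
      by (simp add: fact_numeral power_divide field_simps)
    have var: "expectation (\<lambda>x. (X x)\<^sup>2) = s\<^sup>2"
      using normal_distributed_variance[OF normal] mean by simp
    have "integrable M (\<lambda>x. X x ^ 4)"
      using distributed_integrable[OF normal(2)[unfolded m], of "\<lambda>x. x ^ 4"] moment
      by (auto simp: has_bochner_integral_iff)
    moreover have "expectation (\<lambda>x. X x ^ 4) = 3 * s ^ 4"
      using distributed_integral[OF normal(2)[unfolded m], of "\<lambda>x. x ^ 4"] moment
      by (auto simp: has_bochner_integral_iff)
    ultimately show ?thesis
      by (simp add: var)
  qed
  then show "integrable M (\<lambda>x. X x ^ 4)"
    and "expectation (\<lambda>x. X x ^ 4) = 3 * (expectation (\<lambda>x. (X x)\<^sup>2))\<^sup>2"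
    by auto
qed

text \<open>On a probability space square integrability implies integrability; this is used twice,
  descending from the fourth power to the square and from the square to \<open>X\<close>.\<close>

lemma (in prob_space) gaussian_rv_square_integrable:
  assumes "gaussian_rv M X" "expectation X = 0"
  shows "integrable M (\<lambda>x. (X x)\<^sup>2)" and "integrable M X"
proof -
  have [measurable]: "X \<in> borel_measurable M"
    using assms by (simp add: gaussian_rv_def)
  have "(\<lambda>x. ((X x)\<^sup>2)\<^sup>2) = (\<lambda>x. X x ^ 4)"
    by (simp add: power2_eq_square power4_eq_xxxx mult.assoc)
  then have "integrable M (\<lambda>x. ((X x)\<^sup>2)\<^sup>2)"
    using gaussian_rv_fourth_moment(1)[OF assms] by simp
  then show square: "integrable M (\<lambda>x. (X x)\<^sup>2)"
    by (rule square_integrable_imp_integrable[rotated]) measurable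
  show "integrable M X"
    by (rule square_integrable_imp_integrable[OF _ square]) measurable
qed

text \<open>Write a and b for the variances of \<open>X\<close> and \<open>Y\<close>. Zero
  covariance gives both \<open>X + Y\<close> and \<open>X - Y\<close> variance a + b, and
  polarisation yields (2 * 3(a+b)^2 - 6a^2 - 6b^2) / 12 = ab.\<close>

lemma (in prob_space) gaussian_squares_uncorrelated:
  assumes X: "gaussian_rv M X" "expectation X = 0"
    and Y: "gaussian_rv M Y" "expectation Y = 0"
    and sum: "gaussian_rv M (\<lambda>x. X x + Y x)"
    and diff: "gaussian_rv M (\<lambda>x. X x - Y x)"
    and uncorrelated: "expectation (\<lambda>x. X x * Y x) = 0"
  shows "integrable M (\<lambda>x. (X x)\<^sup>2 * (Y x)\<^sup>2)"
    and "expectation (\<lambda>x. (X x)\<^sup>2 * (Y x)\<^sup>2) =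
      expectation (\<lambda>x. (X x)\<^sup>2) * expectation (\<lambda>x. (Y x)\<^sup>2)"
proof -
  note [simp] = gaussian_rv_square_integrable[OF X] gaussian_rv_square_integrable[OF Y]
    gaussian_rv_fourth_moment(1)[OF X] gaussian_rv_fourth_moment(1)[OF Y]
  let ?S = "\<lambda>x. X x + Y x" and ?D = "\<lambda>x. X x - Y x"
  have S: "expectation ?S = 0" and D: "expectation ?D = 0"
    using X Y by simp_all
  note [simp] = gaussian_rv_square_integrable[OF sum S] gaussian_rv_square_integrable[OF diff D]
    gaussian_rv_fourth_moment(1)[OF sum S] gaussian_rv_fourth_moment(1)[OF diff D]
  \<comment> \<open>Integrability of the product is needed before the expectations of the squares of
    \<open>?S\<close> and \<open>?D\<close> can be split into terms.\<close>
  have "(\<lambda>x. X x * Y x) = (\<lambda>x. ((?S x)\<^sup>2 - (?D x)\<^sup>2) / 4)"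
    by (simp add: power2_eq_square algebra_simps)
  then have [simp]: "integrable M (\<lambda>x. X x * Y x)"
    by simp
  have S2: "(\<lambda>x. (?S x)\<^sup>2) = (\<lambda>x. (X x)\<^sup>2 + (Y x)\<^sup>2 + 2 * (X x * Y x))"
    and D2: "(\<lambda>x. (?D x)\<^sup>2) = (\<lambda>x. (X x)\<^sup>2 + (Y x)\<^sup>2 - 2 * (X x * Y x))"
    by (simp_all add: power2_eq_square algebra_simps)
  have var: "expectation (\<lambda>x. (?S x)\<^sup>2) = expectation (\<lambda>x. (X x)\<^sup>2) + expectation (\<lambda>x. (Y x)\<^sup>2)"
    "expectation (\<lambda>x. (?D x)\<^sup>2) = expectation (\<lambda>x. (X x)\<^sup>2) + expectation (\<lambda>x. (Y x)\<^sup>2)"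
    unfolding S2 D2 by (simp_all add: uncorrelated)
  have polar: "(\<lambda>x. (X x)\<^sup>2 * (Y x)\<^sup>2) =
      (\<lambda>x. (?S x ^ 4 + ?D x ^ 4 - 2 * X x ^ 4 - 2 * Y x ^ 4) / 12)"
    by (rule ext) (simp add: power2_eq_square power4_eq_xxxx algebra_simps)
  show "integrable M (\<lambda>x. (X x)\<^sup>2 * (Y x)\<^sup>2)"
    unfolding polar by simp
  show "expectation (\<lambda>x. (X x)\<^sup>2 * (Y x)\<^sup>2) =
      expectation (\<lambda>x. (X x)\<^sup>2) * expectation (\<lambda>x. (Y x)\<^sup>2)"
    unfolding polar
    by (simp add: gaussian_rv_fourth_moment(2)[OF X] gaussian_rv_fourth_moment(2)[OF Y]
        gaussian_rv_fourth_moment(2)[OF sum S] gaussian_rv_fourth_moment(2)[OF diff D] var)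
      (simp add: power2_eq_square algebra_simps)
qed

section \<open>Second and fourth moments of the process\<close>

lemma gaussian_process_rv:
  assumes "gaussian_process M P W" "A \<in> finite_measure_sets M"
  shows "gaussian_rv P (W A)"
proof -
  have "jointly_gaussian P {A} W"
    using assms by (auto simp: gaussian_process_def)
  from this[unfolded jointly_gaussian_def, rule_format, of "\<lambda>_. 1"]
  show ?thesis by simp
qed

text \<open>Joint Gaussianity is indexed by a set, so for equal \<open>A\<close> and
  \<open>B\<close> the family would collapse to one variable with one coefficient. The sum and the
  difference are the cases c = 1 and c = -1.\<close>

lemma gaussian_process_combination:
  assumes "gaussian_process M P W" "A \<in> finite_measure_sets M" "B \<in> finite_measure_sets M" "A \<noteq> B"
  shows "gaussian_rv P (\<lambda>\<omega>. W A \<omega> + c * W B \<omega>)"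
proof -
  have "jointly_gaussian P {A, B} W"
    using assms by (auto simp: gaussian_process_def)
  from this[unfolded jointly_gaussian_def, rule_format, of "\<lambda>C. if C = A then 1 else c"]
  show ?thesis using assms(4) by simp
qed

text \<open>The fourth power is written as a product of squares to match the diagonal of the mixed
  moments in the series argument.\<close>

lemma gaussian_process_square_moments:
  assumes "prob_space P" and W: "gaussian_process M P W" and A: "A \<in> finite_measure_sets M"
  shows "integrable P (\<lambda>\<omega>. (W A \<omega>)\<^sup>2)"
    and "(\<integral>\<omega>. (W A \<omega>)\<^sup>2 \<partial>P) = measure M A"
    and "integrable P (\<lambda>\<omega>. (W A \<omega>)\<^sup>2 * (W A \<omega>)\<^sup>2)"
    and "(\<integral>\<omega>. (W A \<omega>)\<^sup>2 * (W A \<omega>)\<^sup>2 \<partial>P) = 3 * (measure M A)\<^sup>2"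
proof -
  interpret prob_space P by fact
  have mean: "expectation (W A) = 0"
    using W A by (simp add: gaussian_process_def)
  note G = gaussian_process_rv[OF W A] mean
  have "(\<integral>\<omega>. W A \<omega> * W A \<omega> \<partial>P) = measure M (A \<inter> A)"
    using W A unfolding gaussian_process_def by blast
  then show var: "(\<integral>\<omega>. (W A \<omega>)\<^sup>2 \<partial>P) = measure M A"
    by (simp add: power2_eq_square)
  show "integrable P (\<lambda>\<omega>. (W A \<omega>)\<^sup>2)"
    by (rule gaussian_rv_square_integrable[OF G])
  have "(\<lambda>\<omega>. (W A \<omega>)\<^sup>2 * (W A \<omega>)\<^sup>2) = (\<lambda>\<omega>. W A \<omega> ^ 4)"
    by (simp add: power2_eq_square power4_eq_xxxx mult.assoc)
  then show "integrable P (\<lambda>\<omega>. (W A \<omega>)\<^sup>2 * (W A \<omega>)\<^sup>2)"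
    and "(\<integral>\<omega>. (W A \<omega>)\<^sup>2 * (W A \<omega>)\<^sup>2 \<partial>P) = 3 * (measure M A)\<^sup>2"
    using gaussian_rv_fourth_moment[OF G] var by simp_all
qed

lemma gaussian_process_square_mixed_moment:
  assumes "prob_space P" and W: "gaussian_process M P W"
    and A: "A \<in> finite_measure_sets M" and B: "B \<in> finite_measure_sets M" and "A \<inter> B = {}"
  shows "integrable P (\<lambda>\<omega>. (W A \<omega>)\<^sup>2 * (W B \<omega>)\<^sup>2)"
    and "(\<integral>\<omega>. (W A \<omega>)\<^sup>2 * (W B \<omega>)\<^sup>2 \<partial>P) = measure M A * measure M B"
proof -
  interpret prob_space P by fact
  note sq = gaussian_process_square_moments[OF assms(1) W]
  have mean: "expectation (W A) = 0" "expectation (W B) = 0"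
    using W A B by (simp_all add: gaussian_process_def)
  have "integrable P (\<lambda>\<omega>. (W A \<omega>)\<^sup>2 * (W B \<omega>)\<^sup>2) \<and>
    (\<integral>\<omega>. (W A \<omega>)\<^sup>2 * (W B \<omega>)\<^sup>2 \<partial>P) = measure M A * measure M B"
  proof (cases "A = B")
    \<comment> \<open>Equal disjoint sets are empty, as happens when a partition repeats the empty
      set; the fourth moment is then 0.\<close>
    case True
    then have "A = {}" "B = {}" using assms by auto
    then show ?thesis
      using sq(3,4)[OF A] by simp
  next
    case False
    have "(\<integral>\<omega>. W A \<omega> * W B \<omega> \<partial>P) = measure M (A \<inter> B)"
      using W A B unfolding gaussian_process_def by blast
    then have cov: "(\<integral>\<omega>. W A \<omega> * W B \<omega> \<partial>P) = 0"
      using assms by simp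
    have "gaussian_rv P (\<lambda>\<omega>. W A \<omega> + W B \<omega>)" "gaussian_rv P (\<lambda>\<omega>. W A \<omega> - W B \<omega>)"
      using gaussian_process_combination[OF W A B False, of 1]
        gaussian_process_combination[OF W A B False, of "-1"] by simp_all
    note gaussian_squares_uncorrelated[OF gaussian_process_rv[OF W A] mean(1)
        gaussian_process_rv[OF W B] mean(2) this cov]
    then show ?thesis
      using sq(2)[OF A] sq(2)[OF B] by simp
  qed
  then show "integrable P (\<lambda>\<omega>. (W A \<omega>)\<^sup>2 * (W B \<omega>)\<^sup>2)"
    and "(\<integral>\<omega>. (W A \<omega>)\<^sup>2 * (W B \<omega>)\<^sup>2 \<partial>P) = measure M A * measure M B"
    by auto
qed

section \<open>Random series with nonnegative terms\<close>

text \<open>By monotone convergence the extended-valued sum has finite integral, hence is finite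
  almost everywhere.\<close>

lemma AE_summable_of_summable_integral:
  fixes g :: "nat \<Rightarrow> 'a \<Rightarrow> real"
  assumes int: "\<And>k. integrable M (g k)" and nonneg: "\<And>k x. 0 \<le> g k x"
    and summable: "summable (\<lambda>k. \<integral>x. g k x \<partial>M)"
  shows "AE x in M. summable (\<lambda>k. g k x)"
proof -
  have [measurable]: "g k \<in> borel_measurable M" for k
    using int by auto
  have "(\<integral>\<^sup>+x. (\<Sum>k. ennreal (g k x)) \<partial>M) = (\<Sum>k. \<integral>\<^sup>+x. ennreal (g k x) \<partial>M)"
    by (rule nn_integral_suminf) auto
  also have "\<dots> = (\<Sum>k. ennreal (\<integral>x. g k x \<partial>M))"
    by (simp add: nn_integral_eq_integral int nonneg)
  also have "\<dots> = ennreal (\<Sum>k. \<integral>x. g k x \<partial>M)"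
    by (rule suminf_ennreal2[OF _ summable]) (simp add: nonneg integral_nonneg_AE)
  also have "\<dots> \<noteq> \<infinity>"
    by simp
  finally have "AE x in M. (\<Sum>k. ennreal (g k x)) \<noteq> \<infinity>"
    by (intro nn_integral_PInf_AE) auto
  then show ?thesis
    by eventually_elim (simp add: summable_suminf_not_top nonneg)
qed

text \<open>Here \<open>v k\<close> is the variance of \<open>g k\<close>, and \<open>a\<close> and
  \<open>b\<close> turn out to be the mean and variance of \<open>Y\<close>. Nonnegativity makes
  both the partial sums and their squares increase, so monotone convergence gives both moments of
  \<open>Y\<close>.\<close>

lemma (in prob_space) second_moment_of_uncorrelated_series:
  fixes g :: "nat \<Rightarrow> 'a \<Rightarrow> real"
  assumes int: "\<And>k. integrable M (g k)" and nonneg: "\<And>k x. 0 \<le> g k x"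
    and mean: "\<And>k. expectation (g k) = s k"
    and int2: "\<And>j k. integrable M (\<lambda>x. g j x * g k x)"
    and mixed: "\<And>j k. expectation (\<lambda>x. g j x * g k x) = s j * s k + (if j = k then v k else 0)"
    and s: "s sums a" and v: "v sums b"
    and [measurable]: "Y \<in> borel_measurable M"
    and Y: "AE x in M. (\<lambda>k. g k x) sums Y x"
  shows "has_bochner_integral M (\<lambda>x. (a - Y x)\<^sup>2) b"
proof -
  let ?T = "\<lambda>n x. \<Sum>k<n. g k x"
  have mono: "mono (\<lambda>n. ?T n x)" for x
    by (intro monoI sum_mono2) (auto simp: nonneg)
  have first: "has_bochner_integral M Y a"
  proof (rule has_bochner_integral_monotone_convergence)
    show "integrable M (?T n)" for n
      by (simp add: int)
    show "AE x in M. mono (\<lambda>n. ?T n x)"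
      using mono by simp
    show "AE x in M. (\<lambda>n. ?T n x) \<longlonglongrightarrow> Y x"
      using Y by (simp add: sums_def)
    show "(\<lambda>n. expectation (?T n)) \<longlonglongrightarrow> a"
      using s by (simp add: int mean sums_def)
  qed measurable
  have square: "(\<lambda>x. (?T n x)\<^sup>2) = (\<lambda>x. \<Sum>j<n. \<Sum>k<n. g j x * g k x)" for n
    by (simp add: power2_eq_square sum_product)
  have second: "has_bochner_integral M (\<lambda>x. (Y x)\<^sup>2) (a\<^sup>2 + b)"
  proof (rule has_bochner_integral_monotone_convergence)
    show "integrable M (\<lambda>x. (?T n x)\<^sup>2)" for n
      unfolding square by (simp add: int2)
    have "mono (\<lambda>n. (?T n x)\<^sup>2)" for x
      using mono[of x] by (auto simp: mono_def intro!: power_mono sum_nonneg nonneg)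
    then show "AE x in M. mono (\<lambda>n. (?T n x)\<^sup>2)"
      by simp
    show "AE x in M. (\<lambda>n. (?T n x)\<^sup>2) \<longlonglongrightarrow> (Y x)\<^sup>2"
      using Y by eventually_elim (auto simp: sums_def intro: tendsto_power)
    \<comment> \<open>In the double sum the products \<open>s j * s k\<close> assemble to a square,
      and the diagonal contributes the variances.\<close>
    have "expectation (\<lambda>x. (?T n x)\<^sup>2) = (\<Sum>k<n. s k)\<^sup>2 + (\<Sum>k<n. v k)" for n
      unfolding square
      by (simp add: int2 mixed sum.distrib power2_eq_square sum_product)
    then show "(\<lambda>n. expectation (\<lambda>x. (?T n x)\<^sup>2)) \<longlonglongrightarrow> a\<^sup>2 + b"
      using s v by (auto simp: sums_def intro!: tendsto_intros)
  qed measurable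
  have "(\<lambda>x. (a - Y x)\<^sup>2) = (\<lambda>x. a\<^sup>2 - 2 * a * Y x + (Y x)\<^sup>2)"
    by (simp add: power2_eq_square algebra_simps)
  then show ?thesis
    using first second by (simp add: has_bochner_integral_iff prob_space power2_eq_square)
qed

section \<open>The squared deviation along a partition\<close>

text \<open>\<open>infsum\<close> and the Bochner integral default to 0 without convergence. The
  summability and integrability clauses ensure that the equations concern genuine values.\<close>

theorem proposition3p16:
  fixes M :: "'a measure" and P :: "'w measure" and W :: "'a set \<Rightarrow> 'w \<Rightarrow> real"
    and A :: "'a set" and I :: "nat set" and Q :: "nat \<Rightarrow> 'a set"
  assumes "sigma_finite_measure M"
    and "prob_space P"
    and "gaussian_process M P W"
    and "A \<in> sets M" and "emeasure M A < \<infinity>"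
    and "is_partition M A I Q"
  shows "(AE \<omega> in P. (\<lambda>k. (W (Q k) \<omega>)\<^sup>2) summable_on I) \<and>
    integrable P (\<lambda>\<omega>. \<bar>measure M A - (\<Sum>\<^sub>\<infinity>k\<in>I. (W (Q k) \<omega>)\<^sup>2)\<bar>\<^sup>2) \<and>
    (\<lambda>k. (measure M (Q k))\<^sup>2) summable_on I \<and>
    (\<integral>\<omega>. \<bar>measure M A - (\<Sum>\<^sub>\<infinity>k\<in>I. (W (Q k) \<omega>)\<^sup>2)\<bar>\<^sup>2 \<partial>P)
      = 2 * (\<Sum>\<^sub>\<infinity>k\<in>I. (measure M (Q k))\<^sup>2) \<and>
    2 * (\<Sum>\<^sub>\<infinity>k\<in>I. (measure M (Q k))\<^sup>2)
      = 2 * (\<Sum>\<^sub>\<infinity>k\<in>I. (\<integral>\<omega>. (W (Q k) \<omega>)\<^sup>2 \<partial>P)\<^sup>2)"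
proof -
  interpret P: prob_space P by fact
  have fin: "Q k \<in> finite_measure_sets M" if "k \<in> I" for k
  proof -
    have "Q k \<in> sets M" "Q k \<subseteq> A"
      using assms(6) that by (auto simp: is_partition_def)
    then show ?thesis
      using emeasure_mono[of "Q k" A M] assms(4,5)
      by (auto simp: finite_measure_sets_def intro: le_less_trans)
  qed
  note sq = gaussian_process_square_moments[OF assms(2,3)]
  \<comment> \<open>Extending by 0 outside \<open>I\<close> turns finite and infinite partitions
    alike into series over all naturals.\<close>
  define g where "g k \<omega> = (if k \<in> I then (W (Q k) \<omega>)\<^sup>2 else 0)" for k \<omega>
  define s where "s k = (if k \<in> I then measure M (Q k) else 0)" for k
  define Y where "Y \<omega> = (\<Sum>\<^sub>\<infinity>k\<in>I. (W (Q k) \<omega>)\<^sup>2)" for \<omega>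
  have g_int: "integrable P (g k)" and g_mean: "(\<integral>\<omega>. g k \<omega> \<partial>P) = s k" for k
    unfolding g_def s_def by (cases "k \<in> I"; simp add: sq(1,2)[OF fin])+
  have g_nonneg: "0 \<le> g k \<omega>" for k \<omega>
    by (simp add: g_def)
  have g_meas [measurable]: "g k \<in> borel_measurable P" for k
    using g_int by auto
  \<comment> \<open>On the diagonal the fourth moment 3 s^2 splits as s^2 + 2 s^2; the second
    summand is the variance and the source of the factor 2 in the theorem.\<close>
  have g_mixed: "integrable P (\<lambda>\<omega>. g j \<omega> * g k \<omega>) \<and>
    (\<integral>\<omega>. g j \<omega> * g k \<omega> \<partial>P) = s j * s k + (if j = k then 2 * (s k)\<^sup>2 else 0)" for j k
  proof (cases "j \<in> I \<and> k \<in> I")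
    case True
    show ?thesis
    proof (cases "j = k")
      case True
      then show ?thesis
        using sq(3,4)[OF fin, of k] by (simp add: g_def s_def power2_eq_square)
    next
      case False
      then have "Q j \<inter> Q k = {}"
        using True assms(6) by (auto simp: is_partition_def disjoint_family_on_def)
      then show ?thesis
        using True False
          gaussian_process_square_mixed_moment[OF assms(2,3) fin fin, of j k]
        by (simp add: g_def s_def)
    qed
  qed (auto simp: g_def s_def)

  have s_sums: "s sums measure M A"
  proof -
    define R where "R k = (if k \<in> I then Q k else {})" for k
    have "(\<lambda>k. measure M (R k)) sums measure M (\<Union>k. R k)"
    proof (rule measure_UNION)
      show "range R \<subseteq> sets M" "disjoint_family R"
        using assms(6) by (auto simp: R_def is_partition_def disjoint_family_on_def)
      show "emeasure M (\<Union>k. R k) \<noteq> \<infinity>"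
        using assms(5,6) by (auto simp: R_def is_partition_def)
    qed
    moreover have "(\<Union>k. R k) = A" "(\<lambda>k. measure M (R k)) = s"
      using assms(6) by (auto simp: R_def is_partition_def s_def split: if_splits)
    ultimately show ?thesis by simp
  qed
  have s_nonneg: "0 \<le> s k" for k
    by (simp add: s_def)
  \<comment> \<open>Each term is at most the total mass, so \<open>(s k)^2\<close> is dominated by
    \<open>measure M A * s k\<close>, which is summable.\<close>
  have s_le: "s k \<le> measure M A" for k
    using sum_le_suminf[of s "{k}"] s_sums s_nonneg by (auto simp: sums_iff)
  have s2_summable: "summable (\<lambda>k. (s k)\<^sup>2)"
  proof (rule summable_comparison_test')
    show "summable (\<lambda>k. measure M A * s k)"
      using s_sums by (intro summable_mult) (simp add: sums_iff)
    show "norm ((s k)\<^sup>2) \<le> measure M A * s k" if "0 \<le> k" for k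
      using mult_right_mono[OF s_le s_nonneg] by (simp add: power2_eq_square)
  qed
  have s2_has_sum: "((\<lambda>k. (measure M (Q k))\<^sup>2) has_sum (\<Sum>k. (s k)\<^sup>2)) I"
  proof -
    have "((\<lambda>k. (s k)\<^sup>2) has_sum (\<Sum>k. (s k)\<^sup>2)) UNIV"
      by (intro sums_nonneg_imp_has_sum summable_sums s2_summable) simp
    then show ?thesis
      by (rule has_sum_cong_neutral[THEN iffD1, rotated -1]) (auto simp: s_def)
  qed

  have "AE \<omega> in P. summable (\<lambda>k. g k \<omega>)"
    using s_sums by (intro AE_summable_of_summable_integral g_int g_nonneg)
      (simp add: g_mean sums_iff)
  \<comment> \<open>For nonnegative terms ordinary convergence is unconditional, so almost surely
    the series of \<open>g\<close> and the unordered sum over \<open>I\<close> have the same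
    value.\<close>
  then have has_sum: "AE \<omega> in P. ((\<lambda>k. (W (Q k) \<omega>)\<^sup>2) has_sum (\<Sum>k. g k \<omega>)) I \<and>
    (\<lambda>k. g k \<omega>) sums (\<Sum>k. g k \<omega>)"
  proof eventually_elim
    case (elim \<omega>)
    then have "((\<lambda>k. g k \<omega>) has_sum (\<Sum>k. g k \<omega>)) UNIV"
      by (intro sums_nonneg_imp_has_sum summable_sums g_nonneg)
    then have "((\<lambda>k. (W (Q k) \<omega>)\<^sup>2) has_sum (\<Sum>k. g k \<omega>)) I"
      by (rule has_sum_cong_neutral[THEN iffD1, rotated -1]) (auto simp: g_def)
    then show ?case
      using elim by (simp add: summable_sums)
  qed
  \<comment> \<open>This identity holds at every point, divergent ones included, so \<open>Y\<close>
    is measurable without removing a null set.\<close>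
  have Y_eq: "Y = (\<lambda>\<omega>. enn2real (\<Sum>k. ennreal (g k \<omega>)))"
    unfolding Y_def g_def by (rule ext, rule infsum_nonneg_conv_enn2real) simp
  have Y_meas: "Y \<in> borel_measurable P"
    unfolding Y_eq by measurable
  have "has_bochner_integral P (\<lambda>\<omega>. (measure M A - Y \<omega>)\<^sup>2) (2 * (\<Sum>k. (s k)\<^sup>2))"
  proof (rule P.second_moment_of_uncorrelated_series[OF g_int g_nonneg g_mean _ _ s_sums _ Y_meas])
    show "(\<lambda>k. 2 * (s k)\<^sup>2) sums (2 * (\<Sum>k. (s k)\<^sup>2))"
      by (intro sums_mult summable_sums s2_summable)
    show "AE \<omega> in P. (\<lambda>k. g k \<omega>) sums Y \<omega>"
      using has_sum by eventually_elim (auto simp: Y_def dest: infsumI)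
  qed (use g_mixed in auto)
  moreover have "AE \<omega> in P. (\<lambda>k. (W (Q k) \<omega>)\<^sup>2) summable_on I"
    using has_sum by eventually_elim (auto simp: summable_on_def)
  moreover have "(\<Sum>\<^sub>\<infinity>k\<in>I. (\<integral>\<omega>. (W (Q k) \<omega>)\<^sup>2 \<partial>P)\<^sup>2) = (\<Sum>\<^sub>\<infinity>k\<in>I. (measure M (Q k))\<^sup>2)"
    by (rule infsum_cong) (simp add: sq(2)[OF fin])
  ultimately show ?thesis
    using s2_has_sum infsumI[OF s2_has_sum]
    by (auto simp: has_bochner_integral_iff Y_def summable_on_def)
qed

end
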